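(* Consider the model $$\bar y_j(i/n_j)=a_0+f_j(i/n_j)+\epsilon'(i/n_j),\qquad i=0,\dots,n_j-1,$$ with $\epsilon'(i/n_j)$ independent $\mathcal N\big(0,\frac{n_j}{N}\sigma^2\big)$, where $f_j\in\mathcal F_{n_j}(s_j,R_j)$. There exists a constant $C_2>0$ such that $$\inf_{\tilde f_j}\ \sup_{f_j\in\mathcal F_{n_j}(s_j,R_j)}AMSE(\tilde f_j,f_j)\ \ge\ C_2\min\left(N^{-\frac{2s_j}{2s_j+1}},\frac{n_j}{N}\right),$$ where the infimum is taken over all estimators $\tilde f_j$ of $f_j$.
   Context: The model arises from the additive regression model $y(i_1/n_1,\dots,i_d/n_d)=a_0+\sum_{l=1}^d f_l(i_l/n_l)+\epsilon(i_1/n_1,\dots,i_d/n_d)$, $i_l=0,\dots,n_l-1$, on a regular lattice of size $n_1\times\dots\times n_d$ (all $n_l$ odd), with $N=\prod_{l=1}^d n_l$ observations, independent $\mathcal N(0,\sigma^2)$ noise and $\sum_{i=0}^{n_l-1}f_l(i/n_l)=0$ for all $l$: for a fixed index $j$, $\bar y_j(i/n_j)$ is the average of the $N/n_j$ observations whose $j$-th coordinate equals $i/n_j$. With $I=\sqrt{-1}$, let $c_{kj}=\frac1{n_j}\sum_{i=0}^{n_j-1}f_j(i/n_j)e^{2\pi I k i/n_j}$ for $|k|\le (n_j-1)/2$ be the discrete Fourier coefficients of $f_j$. $\mathcal F_{n_j}(s_j,R_j)$ is the set of functions $f_j$ with $c_{0j}=0$ (i.e. $\sum_i f_j(i/n_j)=0$)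 and $\sum_{|k|\le (n_j-1)/2}|c_{kj}|^2|k|^{2s_j}\le R_j^2$, where $s_j>1/2$ and $R_j<C_R$ for some constant $C_R>0$. The risk is $AMSE(\tilde f_j,f_j)=\frac1{n_j}E\|\tilde f_j-f_j\|_{n_j}^2$, where $\|\cdot\|_{n_j}$ is the Euclidean norm of the vector of values at the $n_j$ grid points. *)

theory Defs
  imports "HOL-Probability.Probability"
begin

text \<open>Only the values \<open>f (i / n)\<close>, \<open>i < n\<close>, of a function on the grid matter below.\<close>

definition fourier_coeff :: "nat \<Rightarrow> (real \<Rightarrow> real) \<Rightarrow> int \<Rightarrow> complex" where
  "fourier_coeff n f k =
     1 / of_nat n *
       (\<Sum>i<n. complex_of_real (f (real i / real n)) *
               exp (2 * complex_of_real pi * \<i> * of_int k * of_nat i / of_nat n))"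

text \<open>Intended for odd \<open>n\<close>. As \<open>0 powr (2 * s) = 0\<close>, the frequency 0 does not contribute
  to the sum.\<close>

definition sobolev_class :: "nat \<Rightarrow> real \<Rightarrow> real \<Rightarrow> (real \<Rightarrow> real) set" where
  "sobolev_class n s R =
     {f. fourier_coeff n f 0 = 0 \<and>
         (\<Sum>k \<in> {- ((int n - 1) div 2) .. (int n - 1) div 2}.
            (cmod (fourier_coeff n f k))\<^sup>2 * \<bar>real_of_int k\<bar> powr (2 * s)) \<le> R\<^sup>2}"

definition grid_norm :: "nat \<Rightarrow> (real \<Rightarrow> real) \<Rightarrow> real" where
  "grid_norm n g = L2_set (\<lambda>i. g (real i / real n)) {..<n}"

text \<open>\<open>normal_density\<close> takes the standard deviation, so each of the \<open>n\<close> independent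
  errors has variance \<open>n / N * \<sigma>\<^sup>2\<close>.\<close>

definition noise :: "nat \<Rightarrow> nat \<Rightarrow> real \<Rightarrow> (nat \<Rightarrow> real) measure" where
  "noise n N \<sigma> =
     (\<Pi>\<^sub>M i\<in>{..<n}. density lborel (normal_density 0 (sqrt (real n / real N * \<sigma>\<^sup>2))))"

definition observation :: "nat \<Rightarrow> real \<Rightarrow> (real \<Rightarrow> real) \<Rightarrow> (nat \<Rightarrow> real) \<Rightarrow> (nat \<Rightarrow> real)" where
  "observation n a0 f \<epsilon> = (\<lambda>i\<in>{..<n}. a0 + f (real i / real n) + \<epsilon> i)"

text \<open>Estimators map the data to a function whose grid values are measurable in the data; they
  may depend on every parameter of the model other than \<open>f\<close>. No integrability is required, the
  risk of an estimator being an extended nonnegative real.\<close>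

definition estimators :: "nat \<Rightarrow> ((nat \<Rightarrow> real) \<Rightarrow> real \<Rightarrow> real) set" where
  "estimators n =
     {T. \<forall>i<n. (\<lambda>y. T y (real i / real n)) \<in> borel_measurable (\<Pi>\<^sub>M i\<in>{..<n}. borel)}"

definition AMSE ::
  "nat \<Rightarrow> nat \<Rightarrow> real \<Rightarrow> real \<Rightarrow> ((nat \<Rightarrow> real) \<Rightarrow> real \<Rightarrow> real) \<Rightarrow> (real \<Rightarrow> real) \<Rightarrow> ennreal" where
  "AMSE n N \<sigma> a0 T f =
     ennreal (1 / real n) *
       (\<integral>\<^sup>+ \<epsilon>. ennreal ((grid_norm n (\<lambda>x. T (observation n a0 f \<epsilon>) x - f x))\<^sup>2) \<partial>noise n N \<sigma>)"

end

theory Submission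
  imports Defs
begin

text \<open>Assouad's argument. The functions
  \<open>f x = \<Sum> k \<le> m. (\<plusminus> \<delta>) * sqrt 2 * cos (2 * pi * k * x)\<close> with all choices of signs form a hypercube,
  orthogonal on the grid because \<open>m \<le> (n - 1) / 2\<close>. With \<open>\<delta>\<^sup>2\<close> equal to
  \<open>min (\<sigma>\<^sup>2) (R\<^sup>2) / N\<close> and \<open>m\<close> the minimum of \<open>(n - 1) / 2\<close> and \<open>N powr (1 / (2 * s + 1))\<close>, rounded
  down, the hypercube lies in the Sobolev class, while the laws of the data at neighbouring vertices
  are Gaussian with means at a bounded distance relative to the noise. Hence each
  sign costs any estimator a risk of order \<open>\<delta>\<^sup>2\<close>, and by Bessel's inequality these costs add up to
  order \<open>m * \<delta>\<^sup>2\<close>, which is the claimed rate.\<close>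

subsection \<open>Products of Gaussian measures\<close>

text \<open>A sigma-finite product measure is determined by its values on rectangles. There the
  indicator factors over the coordinates, and the integral of a product of one-coordinate functions
  is the product of their integrals.\<close>

lemma PiM_density:
  fixes M :: "'i \<Rightarrow> 'a measure" and f :: "'i \<Rightarrow> 'a \<Rightarrow> ennreal"
  assumes M: "\<And>i. sigma_finite_measure (M i)" "\<And>i. sigma_finite_measure (density (M i) (f i))"
    and f[measurable]: "\<And>i. f i \<in> borel_measurable (M i)"
    and I: "finite I"
  shows "PiM I (\<lambda>i. density (M i) (f i)) = density (PiM I M) (\<lambda>x. \<Prod>i\<in>I. f i (x i))"
proof -
  interpret A: product_sigma_finite "\<lambda>i. density (M i) (f i)"
    by (intro product_sigma_finite.intro M)
  interpret B: product_sigma_finite M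
    by (intro product_sigma_finite.intro M)
  have "density (PiM I M) (\<lambda>x. \<Prod>i\<in>I. f i (x i)) = PiM I (\<lambda>i. density (M i) (f i))"
  proof (rule A.PiM_eqI[OF I])
    show "sets (density (PiM I M) (\<lambda>x. \<Prod>i\<in>I. f i (x i))) = sets (PiM I (\<lambda>i. density (M i) (f i)))"
      by (simp cong: sets_PiM_cong)
    fix A assume "\<And>i. i \<in> I \<Longrightarrow> A i \<in> sets (density (M i) (f i))"
    then have A[measurable]: "\<And>i. i \<in> I \<Longrightarrow> A i \<in> sets (M i)" by simp
    have "emeasure (density (PiM I M) (\<lambda>x. \<Prod>i\<in>I. f i (x i))) (Pi\<^sub>E I A)
        = (\<integral>\<^sup>+x. (\<Prod>i\<in>I. f i (x i)) * indicator (Pi\<^sub>E I A) x \<partial>PiM I M)"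
      using I by (intro emeasure_density) (auto intro!: sets_PiM_I_finite A borel_measurable_prod)
    also have "\<dots> = (\<integral>\<^sup>+x. (\<Prod>i\<in>I. f i (x i) * indicator (A i) (x i)) \<partial>PiM I M)"
    proof (rule nn_integral_cong)
      fix x assume x: "x \<in> space (PiM I M)"
      show "(\<Prod>i\<in>I. f i (x i)) * indicator (Pi\<^sub>E I A) x = (\<Prod>i\<in>I. f i (x i) * indicator (A i) (x i))"
      proof (cases "x \<in> Pi\<^sub>E I A")
        case True
        then show ?thesis by (auto simp: PiE_iff intro!: prod.cong)
      next
        case False
        \<comment> \<open>Points of the product space are already extensional on \<open>I\<close>,
          so \<open>x\<close> can miss the rectangle only through a coordinate, and that
          coordinate's factor is 0.\<close>
        then obtain i where "i \<in> I" "x i \<notin> A i"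
          using x by (auto simp: PiE_iff space_PiM)
        then have "(\<Prod>i\<in>I. f i (x i) * indicator (A i) (x i)) = 0"
          using I by (intro prod_zero) (auto intro!: bexI[of _ i])
        with False show ?thesis by simp
      qed
    qed
    also have "\<dots> = (\<Prod>i\<in>I. (\<integral>\<^sup>+x. f i x * indicator (A i) x \<partial>M i))"
      using I by (intro B.product_nn_integral_prod) auto
    also have "\<dots> = (\<Prod>i\<in>I. emeasure (density (M i) (f i)) (A i))"
      by (intro prod.cong) (auto simp: emeasure_density)
    finally show "emeasure (density (PiM I M) (\<lambda>x. \<Prod>i\<in>I. f i (x i))) (Pi\<^sub>E I A) = \<dots>" .
  qed
  then show ?thesis ..
qed

text \<open>The preimage of a rectangle under a coordinatewise map is again a rectangle, so both
  measures give it the same product of probabilities.\<close>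

lemma distr_PiM_coordinatewise:
  fixes M :: "'i \<Rightarrow> 'a measure" and N :: "'i \<Rightarrow> 'b measure"
  assumes M: "\<And>i. prob_space (M i)" and g[measurable]: "\<And>i. g i \<in> measurable (M i) (N i)"
    and I: "finite I"
  shows "distr (PiM I M) (PiM I N) (\<lambda>x. \<lambda>i\<in>I. g i (x i)) = PiM I (\<lambda>i. distr (M i) (N i) (g i))"
proof -
  interpret M: product_prob_space M
    by (rule product_prob_spaceI) (rule M)
  interpret D: product_sigma_finite "\<lambda>i. distr (M i) (N i) (g i)"
    by (rule product_sigma_finite.intro, rule prob_space_imp_sigma_finite, rule prob_space.prob_space_distr, rule M, rule g)
  show ?thesis
  proof (rule D.PiM_eqI[OF I])
    show "sets (distr (PiM I M) (PiM I N) (\<lambda>x. \<lambda>i\<in>I. g i (x i)))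
        = sets (PiM I (\<lambda>i. distr (M i) (N i) (g i)))"
      by (simp cong: sets_PiM_cong)
    fix A assume "\<And>i. i \<in> I \<Longrightarrow> A i \<in> sets (distr (M i) (N i) (g i))"
    then have A[measurable]: "\<And>i. i \<in> I \<Longrightarrow> A i \<in> sets (N i)" by simp
    have "emeasure (distr (PiM I M) (PiM I N) (\<lambda>x. \<lambda>i\<in>I. g i (x i))) (Pi\<^sub>E I A)
        = emeasure (PiM I M) ((\<lambda>x. \<lambda>i\<in>I. g i (x i)) -` Pi\<^sub>E I A \<inter> space (PiM I M))"
      using I by (intro emeasure_distr) (auto intro!: sets_PiM_I_finite A)
    also have "(\<lambda>x. \<lambda>i\<in>I. g i (x i)) -` Pi\<^sub>E I A \<inter> space (PiM I M)
        = Pi\<^sub>E I (\<lambda>i. g i -` A i \<inter> space (M i))"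
      by (auto simp: space_PiM PiE_iff)
    also have "emeasure (PiM I M) \<dots> = (\<Prod>i\<in>I. emeasure (M i) (g i -` A i \<inter> space (M i)))"
      using I by (intro M.emeasure_PiM) auto
    also have "\<dots> = (\<Prod>i\<in>I. emeasure (distr (M i) (N i) (g i)) (A i))"
      by (intro prod.cong) (auto simp: emeasure_distr)
    finally show "emeasure (distr (PiM I M) (PiM I N) (\<lambda>x. \<lambda>i\<in>I. g i (x i))) (Pi\<^sub>E I A) = \<dots>" .
  qed
qed

text \<open>Lebesgue measure is translation invariant: the substitution of \<open>c + x\<close> for
  \<open>x\<close> carries the density centred at \<open>c\<close> to the one centred at 0.\<close>

lemma distr_normal_shift:
  fixes c \<tau> :: real
  shows "distr (density lborel (normal_density 0 \<tau>)) borel (\<lambda>x. c + x)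
       = density lborel (normal_density c \<tau>)"
proof (rule measure_eqI)
  fix A assume "A \<in> sets (distr (density lborel (normal_density 0 \<tau>)) borel ((+) c))"
  then have A[measurable]: "A \<in> sets borel" by simp
  have "emeasure (density lborel (normal_density c \<tau>)) A
      = (\<integral>\<^sup>+x. ennreal (normal_density c \<tau> (c + 1 * x)) * indicator A (c + 1 * x) \<partial>lborel)"
    by (subst emeasure_density, simp, simp, subst nn_integral_real_affine[where c=1 and t=c]) auto
  also have "\<dots> = (\<integral>\<^sup>+x. ennreal (normal_density 0 \<tau> x) * indicator ((+) c -` A) x \<partial>lborel)"
    by (intro nn_integral_cong) (auto simp: normal_density_def split: split_indicator)
  also have "\<dots> = emeasure (density lborel (normal_density 0 \<tau>)) ((+) c -` A)"
    using measurable_sets[of "(+) c" borel borel A] by (intro emeasure_density[symmetric]) auto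
  also have "\<dots> = emeasure (distr (density lborel (normal_density 0 \<tau>)) borel ((+) c)) A"
    by (simp add: emeasure_distr)
  finally show "emeasure (distr (density lborel (normal_density 0 \<tau>)) borel ((+) c)) A
      = emeasure (density lborel (normal_density c \<tau>)) A" ..
qed simp

definition gauss_density :: "'i set \<Rightarrow> real \<Rightarrow> ('i \<Rightarrow> real) \<Rightarrow> ('i \<Rightarrow> real) \<Rightarrow> real" where
  "gauss_density I \<tau> \<mu> y = (\<Prod>i\<in>I. normal_density (\<mu> i) \<tau> (y i))"

lemma borel_measurable_gauss_density[measurable]:
  "gauss_density I \<tau> \<mu> \<in> borel_measurable (PiM I (\<lambda>_. borel))"
  unfolding gauss_density_def[abs_def] by measurable

lemma gauss_density_pos: "\<tau> > 0 \<Longrightarrow> gauss_density I \<tau> \<mu> y > 0"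
  unfolding gauss_density_def by (intro prod_pos) (auto intro: normal_density_pos)

lemma PiM_normal:
  assumes "finite I" "\<tau> > 0"
  shows "PiM I (\<lambda>i. density lborel (normal_density (\<mu> i) \<tau>))
       = density (PiM I (\<lambda>_. lborel)) (\<lambda>y. ennreal (gauss_density I \<tau> \<mu> y))"
  using assms
  by (subst PiM_density) (auto intro!: prob_space_imp_sigma_finite prob_space_normal_density
      sigma_finite_lborel simp: gauss_density_def prod_ennreal)

text \<open>The laws of the data under different mean vectors all get densities with respect to the
  same Lebesgue product, so that risks at two means can be compared under a single integral.\<close>

lemma distr_shifted_noise:
  assumes "finite I" "\<tau> > 0"
  shows "distr (PiM I (\<lambda>_. density lborel (normal_density 0 \<tau>))) (PiM I (\<lambda>_. borel))
           (\<lambda>\<epsilon>. \<lambda>i\<in>I. \<mu> i + \<epsilon> i)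
       = density (PiM I (\<lambda>_. lborel)) (\<lambda>y. ennreal (gauss_density I \<tau> \<mu> y))"
  using assms
  by (subst distr_PiM_coordinatewise)
     (auto simp: prob_space_normal_density distr_normal_shift PiM_normal)

lemma nn_integral_gauss_density:
  assumes "finite I" "\<tau> > 0"
  shows "(\<integral>\<^sup>+y. ennreal (gauss_density I \<tau> \<mu> y) \<partial>PiM I (\<lambda>_. lborel)) = 1"
proof -
  interpret prob_space "PiM I (\<lambda>i. density lborel (normal_density (\<mu> i) \<tau>))"
    by (intro prob_space_PiM prob_space_normal_density) (use assms in auto)
  have "gauss_density I \<tau> \<mu> \<in> borel_measurable (PiM I (\<lambda>_. lborel))"
    by (simp cong: measurable_cong_sets sets_PiM_cong)
  then have "(\<integral>\<^sup>+y. ennreal (gauss_density I \<tau> \<mu> y) \<partial>PiM I (\<lambda>_. lborel))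
      = (\<integral>\<^sup>+y. 1 \<partial>density (PiM I (\<lambda>_. lborel)) (\<lambda>y. ennreal (gauss_density I \<tau> \<mu> y)))"
    by (subst nn_integral_density) auto
  then show ?thesis
    using emeasure_space_1 unfolding PiM_normal[OF assms] by simp
qed

section \<open>Two-point lower bound for Gaussian shifts\<close>

text \<open>Parallelogram law in the exponent: (x - a)^2 + (x - b)^2 is twice the squared distance
  from x to the midpoint, plus (a - b)^2 / 2.\<close>

lemma normal_density_mult_midpoint:
  assumes "\<tau> > 0"
  shows "normal_density a \<tau> x * normal_density b \<tau> x
       = (normal_density ((a + b) / 2) \<tau> x)\<^sup>2 * exp (- (a - b)\<^sup>2 / (4 * \<tau>\<^sup>2))"
proof -
  have "- (x - a)\<^sup>2 / (2 * \<tau>\<^sup>2) + - (x - b)\<^sup>2 / (2 * \<tau>\<^sup>2)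
      = 2 * (- (x - (a + b) / 2)\<^sup>2 / (2 * \<tau>\<^sup>2)) + - (a - b)\<^sup>2 / (4 * \<tau>\<^sup>2)"
    using assms by (simp add: field_simps power2_eq_square)
  then have "exp (- (x - a)\<^sup>2 / (2 * \<tau>\<^sup>2)) * exp (- (x - b)\<^sup>2 / (2 * \<tau>\<^sup>2))
      = (exp (- (x - (a + b) / 2)\<^sup>2 / (2 * \<tau>\<^sup>2)))\<^sup>2 * exp (- (a - b)\<^sup>2 / (4 * \<tau>\<^sup>2))"
    by (metis exp_add exp_double)
  then show ?thesis
    unfolding normal_density_def power_mult_distrib by (simp add: power2_eq_square)
qed

lemma gauss_density_mult_midpoint:
  assumes "\<tau> > 0"
  shows "gauss_density I \<tau> \<mu> y * gauss_density I \<tau> \<nu> y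
       = (gauss_density I \<tau> (\<lambda>i. (\<mu> i + \<nu> i) / 2) y)\<^sup>2
         * exp (- (\<Sum>i\<in>I. (\<mu> i - \<nu> i)\<^sup>2) / (4 * \<tau>\<^sup>2))"
proof (cases "finite I")
  case True
  have "exp (- (\<Sum>i\<in>I. (\<mu> i - \<nu> i)\<^sup>2) / (4 * \<tau>\<^sup>2)) = (\<Prod>i\<in>I. exp (- (\<mu> i - \<nu> i)\<^sup>2 / (4 * \<tau>\<^sup>2)))"
    using True by (simp add: exp_sum[symmetric] sum_negf sum_divide_distrib)
  then show ?thesis
    unfolding gauss_density_def
    by (simp add: prod.distrib[symmetric] prod_power_distrib normal_density_mult_midpoint[OF assms])
\<comment> \<open>For infinite \<open>I\<close> the products default to 1 and the sum to 0, so both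
  sides are 1.\<close>
qed (simp add: gauss_density_def)

text \<open>If \<open>p\<close> and \<open>p'\<close> are Gaussian densities and \<open>q\<close> is the one centred at the midpoint of
  their means, then \<open>p p' / q\<^sup>2\<close> is a constant \<open>E\<close>; the bound below has only densities on both
  sides, so it integrates to \<open>E (a - b)\<^sup>2 / 2\<close> without estimating any total variation distance.\<close>
lemma two_point_pointwise:
  fixes p p' q E A B :: real
  assumes "p > 0" "p' > 0" "E \<ge> 0" "p * p' = q\<^sup>2 * E"
  shows "E * (A - B)\<^sup>2 * q \<le> p * A\<^sup>2 + p' * B\<^sup>2 + E * (A - B)\<^sup>2 / 4 * (p + p')"
proof -
  let ?s = "p + p'"
  have s: "?s > 0" using assms by simp
  \<comment> \<open>The claim is proved after multiplication by \<open>p + p'\<close>; the gap in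
    this weighted Cauchy-Schwarz bound is a perfect square.\<close>
  have "p * p' * (A - B)\<^sup>2 \<le> ?s * (p * A\<^sup>2 + p' * B\<^sup>2)"
  proof -
    have "?s * (p * A\<^sup>2 + p' * B\<^sup>2) - p * p' * (A - B)\<^sup>2 = (p * A + p' * B)\<^sup>2"
      by (simp add: power2_eq_square algebra_simps)
    then show ?thesis by (smt (verit) zero_le_power2)
  qed
  then have 1: "E * (A - B)\<^sup>2 * q\<^sup>2 \<le> ?s * (p * A\<^sup>2 + p' * B\<^sup>2)"
    using assms(4) by (simp add: mult_ac)
  \<comment> \<open>AM-GM trades the linear \<open>q\<close> for \<open>q\<^sup>2\<close>, which the
    previous bound controls. The price, a quarter of the squared sum, becomes the last term of the
    claim once \<open>p + p'\<close> is divided out.\<close>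
  have "?s * q \<le> q\<^sup>2 + ?s\<^sup>2 / 4"
    using zero_le_power2[of "q - ?s / 2"] by (simp add: power2_eq_square algebra_simps)
  then have "E * (A - B)\<^sup>2 * (?s * q) \<le> E * (A - B)\<^sup>2 * (q\<^sup>2 + ?s\<^sup>2 / 4)"
    using assms by (intro mult_left_mono) auto
  moreover have "?s * (c * q) \<le> ?s * (t + c / 4 * ?s)"
    if "c * q\<^sup>2 \<le> ?s * t" "c * (?s * q) \<le> c * (q\<^sup>2 + ?s\<^sup>2 / 4)" for c t
    using that by (simp add: power2_eq_square algebra_simps)
  ultimately have "?s * (E * (A - B)\<^sup>2 * q) \<le> ?s * (p * A\<^sup>2 + p' * B\<^sup>2 + E * (A - B)\<^sup>2 / 4 * ?s)"
    using 1 by blast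
  then show ?thesis using s by simp
qed

text \<open>No statistic \<open>X\<close> can be close to \<open>a\<close> under mean
  \<open>\<mu>\<close> and to \<open>b\<close> under mean \<open>\<nu>\<close> when the two laws
  overlap. The proof integrates \<open>two_point_pointwise\<close> with \<open>A = X y - a\<close>
  and \<open>B = X y - b\<close>, whose difference is free of \<open>y\<close>; the three densities
  each have mass 1.\<close>

lemma two_point_lower_bound:
  fixes X :: "('i \<Rightarrow> real) \<Rightarrow> real"
  assumes I: "finite I" and \<tau>: "\<tau> > 0"
    and X[measurable]: "X \<in> borel_measurable (PiM I (\<lambda>_. borel))"
  shows "ennreal ((a - b)\<^sup>2 / 2 * exp (- (\<Sum>i\<in>I. (\<mu> i - \<nu> i)\<^sup>2) / (4 * \<tau>\<^sup>2)))
    \<le> (\<integral>\<^sup>+\<epsilon>. ennreal ((X (\<lambda>i\<in>I. \<mu> i + \<epsilon> i) - a)\<^sup>2)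
          \<partial>PiM I (\<lambda>_. density lborel (normal_density 0 \<tau>)))
      + (\<integral>\<^sup>+\<epsilon>. ennreal ((X (\<lambda>i\<in>I. \<nu> i + \<epsilon> i) - b)\<^sup>2)
          \<partial>PiM I (\<lambda>_. density lborel (normal_density 0 \<tau>)))"
    (is "_ \<le> ?L \<mu> a + ?L \<nu> b")
proof -
  let ?M = "PiM I (\<lambda>_. lborel :: real measure)"
  let ?p = "gauss_density I \<tau>"
  have meas: "measurable ?M borel = measurable (PiM I (\<lambda>_. borel)) (borel :: 'z::topological_space measure)"
    by (intro measurable_cong_sets sets_PiM_cong) auto
  have [measurable]: "X \<in> borel_measurable ?M" "\<And>\<mu>. ?p \<mu> \<in> borel_measurable ?M"
    by (simp_all add: meas)
  have L: "?L \<mu> a = (\<integral>\<^sup>+y. ennreal (?p \<mu> y * (X y - a)\<^sup>2) \<partial>?M)" for \<mu> a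
  proof -
    have "?L \<mu> a = (\<integral>\<^sup>+y. ennreal ((X y - a)\<^sup>2) \<partial>distr (PiM I (\<lambda>_. density lborel (normal_density 0 \<tau>)))
        (PiM I (\<lambda>_. borel)) (\<lambda>\<epsilon>. \<lambda>i\<in>I. \<mu> i + \<epsilon> i))"
      by (subst nn_integral_distr) auto
    also have "\<dots> = (\<integral>\<^sup>+y. ennreal (?p \<mu> y * (X y - a)\<^sup>2) \<partial>?M)"
      unfolding distr_shifted_noise[OF I \<tau>]
      by (subst nn_integral_density) (auto simp: ennreal_mult' less_imp_le[OF gauss_density_pos[OF \<tau>]])
    finally show ?thesis .
  qed
  define E where "E = exp (- (\<Sum>i\<in>I. (\<mu> i - \<nu> i)\<^sup>2) / (4 * \<tau>\<^sup>2))"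
  define K where "K = E * (a - b)\<^sup>2"
  define q where "q = ?p (\<lambda>i. (\<mu> i + \<nu> i) / 2)"
  have [measurable]: "q \<in> borel_measurable ?M" by (simp add: q_def)
  have pos: "?p \<mu> y > 0" "?p \<mu> y \<ge> 0" for \<mu> y
    using gauss_density_pos[OF \<tau>, of I \<mu> y] by auto
  have K: "K \<ge> 0" by (simp add: K_def E_def)
  have pw: "K * q y \<le> ?p \<mu> y * (X y - a)\<^sup>2 + ?p \<nu> y * (X y - b)\<^sup>2 + K / 4 * (?p \<mu> y + ?p \<nu> y)" for y
    using two_point_pointwise[of "?p \<mu> y" "?p \<nu> y" E "q y" "X y - a" "X y - b"] pos
      gauss_density_mult_midpoint[OF \<tau>, of I \<mu> y \<nu>]
    by (simp add: E_def K_def q_def power2_commute[of a b])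
  have "ennreal K = ennreal K * (\<integral>\<^sup>+y. ennreal (q y) \<partial>?M)"
    by (simp add: q_def nn_integral_gauss_density[OF I \<tau>])
  also have "\<dots> = (\<integral>\<^sup>+y. ennreal (K * q y) \<partial>?M)"
    using K by (subst nn_integral_cmult[symmetric]) (auto simp: ennreal_mult')
  also have "\<dots> \<le> (\<integral>\<^sup>+y. (ennreal (?p \<mu> y * (X y - a)\<^sup>2) + ennreal (?p \<nu> y * (X y - b)\<^sup>2))
      + ennreal (K / 4) * (ennreal (?p \<mu> y) + ennreal (?p \<nu> y)) \<partial>?M)"
    using pw pos K
    by (intro nn_integral_mono)
       (simp add: ennreal_plus[symmetric] ennreal_mult'[symmetric] ennreal_leI del: ennreal_plus)
  also have "\<dots> = (?L \<mu> a + ?L \<nu> b) + ennreal (K / 4) * (1 + 1)"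
    unfolding L by (simp add: nn_integral_add nn_integral_cmult nn_integral_gauss_density[OF I \<tau>])
  also have "ennreal (K / 4) * (1 + 1) = ennreal (K / 2)"
    using K by (simp add: distrib_left ennreal_plus[symmetric] del: ennreal_plus one_add_one)
  \<comment> \<open>The integrated bound reads K \<le> risks + K / 2; the half is finite, so it
    cancels even if a risk is infinite.\<close>
  finally have "ennreal (K / 2) + ennreal (K / 2) \<le> (?L \<mu> a + ?L \<nu> b) + ennreal (K / 2)"
    using K by (simp add: ennreal_plus[symmetric] del: ennreal_plus)
  then have "ennreal (K / 2) \<le> ?L \<mu> a + ?L \<nu> b"
    by (simp add: ennreal_add_left_cancel_le add.commute)
  then show ?thesis unfolding K_def E_def by (simp only: mult.commute[of _ "(a - b)\<^sup>2"] times_divide_eq_left)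
qed

subsection \<open>Trigonometric functions on the grid\<close>

text \<open>A geometric sum over an n-th root of unity \<open>z\<close>: it vanishes unless
  \<open>z = 1\<close>, which happens exactly when \<open>n\<close> divides
  \<open>k\<close>.\<close>

lemma sum_cis_roots_of_unity:
  assumes "n > 0"
  shows "(\<Sum>i<n. cis (2 * pi * real_of_int k * real i / real n))
       = (if int n dvd k then of_nat n else 0)"
proof -
  define z where "z = cis (2 * pi * real_of_int k / real n)"
  have pow: "cis (2 * pi * real_of_int k * real i / real n) = z ^ i" for i
    unfolding z_def Complex.DeMoivre by (simp add: mult_ac)
  have "z ^ n = 1"
    unfolding z_def Complex.DeMoivre using assms cis_multiple_2pi[of "real_of_int k"] by simp
  moreover have "z = 1 \<longleftrightarrow> int n dvd k"
  proof
    assume "z = 1"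
    then have "cos (2 * pi * real_of_int k / real n) = 1"
      by (metis z_def cis.simps(1) one_complex.simps(1))
    then obtain j :: int where "2 * pi * real_of_int k / real n = real_of_int j * 2 * pi"
      unfolding cos_one_2pi_int by blast
    then have "real_of_int k = real_of_int (j * int n)"
      using assms by (simp add: field_simps)
    then have "k = j * int n" by linarith
    then show "int n dvd k" by simp
  next
    assume "int n dvd k"
    then obtain j where "k = int n * j" ..
    then show "z = 1"
      using assms cis_multiple_2pi[of "real_of_int j"] by (simp add: z_def mult.assoc)
  qed
  ultimately show ?thesis
    using assms by (simp add: pow sum_gp_strict)
qed

text \<open>The factor \<open>sqrt 2\<close> gives mean square 1 over the grid for every frequency
  strictly between 0 and n / 2.\<close>

definition grid_cos :: "nat \<Rightarrow> real \<Rightarrow> real" where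
  "grid_cos k x = sqrt 2 * cos (2 * pi * real k * x)"

lemma complex_grid_cos:
  "complex_of_real (grid_cos k x)
     = complex_of_real (sqrt 2 / 2) * (cis (2 * pi * real k * x) + cis (- (2 * pi * real k * x)))"
  by (simp add: grid_cos_def complex_eq_iff)

text \<open>The cosine splits into exponentials of frequencies \<open>k\<close> and
  \<open>- k\<close>, so the coefficient reduces to two sums of roots of unity, and the two
  frequencies of absolute value \<open>k\<close> share the mass equally.\<close>

lemma fourier_coeff_grid_cos:
  assumes n: "n > 0" and k: "k \<ge> 1" "2 * k < n" and \<nu>: "2 * \<bar>\<nu>\<bar> < int n"
  shows "fourier_coeff n (grid_cos k) \<nu> = (if nat \<bar>\<nu>\<bar> = k then complex_of_real (sqrt 2 / 2) else 0)"
proof -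
  let ?c = "complex_of_real (sqrt 2 / 2)"
  let ?S = "\<lambda>j. \<Sum>i<n. cis (2 * pi * real_of_int j * real i / real n)"
  have "complex_of_real (grid_cos k (real i / real n)) *
          exp (2 * complex_of_real pi * \<i> * of_int \<nu> * of_nat i / of_nat n)
      = ?c * (cis (2 * pi * real_of_int (\<nu> + int k) * real i / real n)
            + cis (2 * pi * real_of_int (\<nu> - int k) * real i / real n))" for i
  proof -
    have "exp (2 * complex_of_real pi * \<i> * of_int \<nu> * of_nat i / of_nat n)
        = cis (2 * pi * real_of_int \<nu> * real i / real n)"
      by (simp add: cis_conv_exp mult_ac)
    then show ?thesis
      by (simp add: complex_grid_cos distrib_right cis_mult mult.assoc)
         (simp add: add_divide_distrib diff_divide_distrib algebra_simps)
  qed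
  then have "fourier_coeff n (grid_cos k) \<nu>
      = 1 / of_nat n * (\<Sum>i<n. ?c * (cis (2 * pi * real_of_int (\<nu> + int k) * real i / real n)
            + cis (2 * pi * real_of_int (\<nu> - int k) * real i / real n)))"
    unfolding fourier_coeff_def by (simp only:)
  also have "\<dots> = 1 / of_nat n * (?c * (?S (\<nu> + int k) + ?S (\<nu> - int k)))"
    by (simp only: sum_distrib_left[symmetric] sum.distrib)
  \<comment> \<open>No aliasing: both frequencies lie below n / 2 in absolute value, so their sum
    and difference lie below \<open>n\<close> and are divisible by \<open>n\<close> only when
    zero.\<close>
  also have "?S (\<nu> + int k) = (if \<nu> = - int k then of_nat n else 0)"
    unfolding sum_cis_roots_of_unity[OF n]
    using zdvd_not_zless[of "\<bar>\<nu> + int k\<bar>" "int n"] k \<nu> by (auto simp: dvd_abs_iff)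
  also have "?S (\<nu> - int k) = (if \<nu> = int k then of_nat n else 0)"
    unfolding sum_cis_roots_of_unity[OF n]
    using zdvd_not_zless[of "\<bar>\<nu> - int k\<bar>" "int n"] k \<nu> by (auto simp: dvd_abs_iff)
  also have "1 / of_nat n * (?c * ((if \<nu> = - int k then of_nat n else 0) + (if \<nu> = int k then of_nat n else 0)))
      = (if nat \<bar>\<nu>\<bar> = k then ?c else 0)"
    using n k by auto
  finally show ?thesis .
qed

lemma fourier_coeff_sum:
  "fourier_coeff n (\<lambda>x. \<Sum>k\<in>K. a k * f k x) \<nu>
     = (\<Sum>k\<in>K. complex_of_real (a k) * fourier_coeff n (f k) \<nu>)"
proof -
  have "fourier_coeff n (\<lambda>x. \<Sum>k\<in>K. a k * f k x) \<nu> = 1 / of_nat n * (\<Sum>i<n. \<Sum>k\<in>K.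
      complex_of_real (a k) * (complex_of_real (f k (real i / real n)) *
               exp (2 * complex_of_real pi * \<i> * of_int \<nu> * of_nat i / of_nat n)))"
    unfolding fourier_coeff_def by (simp add: sum_distrib_right mult.assoc)
  also have "\<dots> = (\<Sum>k\<in>K. complex_of_real (a k) * fourier_coeff n (f k) \<nu>)"
    unfolding fourier_coeff_def by (subst sum.swap) (simp add: sum_distrib_left mult_ac)
  finally show ?thesis .
qed

text \<open>The inner product is \<open>sqrt 2 * n\<close> times the real part of a Fourier
  coefficient of \<open>grid_cos k\<close>. Orthonormality refers to the inner product averaged over
  the grid; the plain sum of squares is \<open>n\<close>.\<close>

lemma grid_cos_orthonormal:
  assumes k: "k \<ge> 1" "2 * k < n" and l: "l \<ge> 1" "2 * l < n"
  shows "(\<Sum>i<n. grid_cos k (real i / real n) * grid_cos l (real i / real n))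
       = (if k = l then real n else 0)"
proof -
  have n: "n > 0" using k by simp
  have "Re (of_nat n * fourier_coeff n (grid_cos k) (int l))
      = (\<Sum>i<n. Re (complex_of_real (grid_cos k (real i / real n)) *
               exp (2 * complex_of_real pi * \<i> * of_int (int l) * of_nat i / of_nat n)))"
    using n unfolding fourier_coeff_def by (simp only: Re_sum[symmetric]) simp
  also have "\<dots> = (\<Sum>i<n. grid_cos k (real i / real n) * cos (2 * pi * real l * (real i / real n)))"
  proof (rule sum.cong)
    fix i
    have "exp (2 * complex_of_real pi * \<i> * of_int (int l) * of_nat i / of_nat n)
        = cis (2 * pi * real l * (real i / real n))"
      by (simp add: cis_conv_exp mult_ac)
    then show "Re (complex_of_real (grid_cos k (real i / real n)) *
               exp (2 * complex_of_real pi * \<i> * of_int (int l) * of_nat i / of_nat n))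
      = grid_cos k (real i / real n) * cos (2 * pi * real l * (real i / real n))"
      by simp
  qed simp
  finally have "(\<Sum>i<n. grid_cos k (real i / real n) * grid_cos l (real i / real n))
      = sqrt 2 * Re (of_nat n * fourier_coeff n (grid_cos k) (int l))"
    by (simp add: grid_cos_def sum_distrib_left mult_ac)
  also have "\<dots> = (if k = l then real n else 0)"
    using k l n by (subst fourier_coeff_grid_cos) auto
  finally show ?thesis .
qed

text \<open>The squared length of \<open>g\<close> minus its projection on the span of the
  \<open>e k\<close> is nonnegative; by orthogonality it is the squared length of \<open>g\<close>
  minus \<open>c\<close> times the sum of the squared coefficients \<open>a k\<close>.\<close>

lemma bessel_inequality:
  fixes g :: "'i \<Rightarrow> real" and e :: "'k \<Rightarrow> 'i \<Rightarrow> real"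
  assumes K: "finite K" and c: "c > 0"
    and orth: "\<And>k l. k \<in> K \<Longrightarrow> l \<in> K \<Longrightarrow> (\<Sum>i\<in>I. e k i * e l i) = (if k = l then c else 0)"
  shows "(\<Sum>k\<in>K. ((\<Sum>i\<in>I. g i * e k i) / c)\<^sup>2) \<le> (\<Sum>i\<in>I. (g i)\<^sup>2) / c"
proof -
  define a where "a k = (\<Sum>i\<in>I. g i * e k i) / c" for k
  have ga: "(\<Sum>i\<in>I. g i * e k i) = c * a k" for k
    using c by (simp add: a_def)
  have cross: "(\<Sum>i\<in>I. g i * (\<Sum>k\<in>K. a k * e k i)) = c * (\<Sum>k\<in>K. (a k)\<^sup>2)"
  proof -
    have "(\<Sum>i\<in>I. g i * (\<Sum>k\<in>K. a k * e k i)) = (\<Sum>k\<in>K. a k * (\<Sum>i\<in>I. g i * e k i))"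
      unfolding sum_distrib_left by (subst sum.swap) (simp add: mult_ac)
    then show ?thesis
      by (simp add: ga sum_distrib_left power2_eq_square mult_ac)
  qed
  have square: "(\<Sum>i\<in>I. (\<Sum>k\<in>K. a k * e k i)\<^sup>2) = c * (\<Sum>k\<in>K. (a k)\<^sup>2)"
  proof -
    have "(\<Sum>i\<in>I. (\<Sum>k\<in>K. a k * e k i)\<^sup>2) = (\<Sum>i\<in>I. \<Sum>k\<in>K. \<Sum>l\<in>K. a k * a l * (e k i * e l i))"
      by (simp add: power2_eq_square sum_product mult_ac)
    also have "\<dots> = (\<Sum>k\<in>K. \<Sum>i\<in>I. \<Sum>l\<in>K. a k * a l * (e k i * e l i))"
      by (rule sum.swap)
    also have "\<dots> = (\<Sum>k\<in>K. \<Sum>l\<in>K. \<Sum>i\<in>I. a k * a l * (e k i * e l i))"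
      by (intro sum.cong refl sum.swap)
    also have "\<dots> = (\<Sum>k\<in>K. \<Sum>l\<in>K. a k * a l * (if k = l then c else 0))"
      by (simp add: sum_distrib_left[symmetric] orth)
    also have "\<dots> = c * (\<Sum>k\<in>K. (a k)\<^sup>2)"
      using K by (simp add: if_distrib[of "\<lambda>x. _ * x"] sum.delta sum_distrib_left power2_eq_square mult_ac
          cong: if_cong)
    finally show ?thesis .
  qed
  have "0 \<le> (\<Sum>i\<in>I. (g i - (\<Sum>k\<in>K. a k * e k i))\<^sup>2)"
    by (intro sum_nonneg) simp
  also have "\<dots> = (\<Sum>i\<in>I. (g i)\<^sup>2) - c * (\<Sum>k\<in>K. (a k)\<^sup>2)"
    by (simp add: power2_diff sum.distrib sum_subtractf square mult.assoc sum_distrib_left[symmetric] cross)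
  finally show ?thesis
    using c by (simp add: a_def[symmetric] field_simps)
qed

section \<open>The hypercube inside the Sobolev class\<close>

text \<open>A vertex of the hypercube is encoded by the set \<open>S\<close> of frequencies that carry a positive
  sign.\<close>

definition vertex_sign :: "nat set \<Rightarrow> nat \<Rightarrow> real" where
  "vertex_sign S k = (if k \<in> S then 1 else - 1)"

definition cube_vertex :: "real \<Rightarrow> nat \<Rightarrow> nat set \<Rightarrow> real \<Rightarrow> real" where
  "cube_vertex \<delta> m S x = (\<Sum>k\<in>{1..m}. \<delta> * vertex_sign S k * grid_cos k x)"

lemma fourier_coeff_cube_vertex:
  assumes "2 * m < n" "2 * \<bar>\<nu>\<bar> < int n"
  shows "fourier_coeff n (cube_vertex \<delta> m S) \<nu>
       = (if nat \<bar>\<nu>\<bar> \<in> {1..m} then complex_of_real (\<delta> * vertex_sign S (nat \<bar>\<nu>\<bar>) * (sqrt 2 / 2)) else 0)"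
proof -
  have "fourier_coeff n (cube_vertex \<delta> m S) \<nu>
      = (\<Sum>k\<in>{1..m}. complex_of_real (\<delta> * vertex_sign S k) * fourier_coeff n (grid_cos k) \<nu>)"
    unfolding cube_vertex_def[abs_def] by (rule fourier_coeff_sum)
  also have "\<dots> = (\<Sum>k\<in>{1..m}. if nat \<bar>\<nu>\<bar> = k
      then complex_of_real (\<delta> * vertex_sign S k * (sqrt 2 / 2)) else 0)"
    using assms by (intro sum.cong) (auto simp: fourier_coeff_grid_cos)
  finally show ?thesis by (simp add: sum.delta')
qed

text \<open>Each of the 2 m frequencies with absolute value from 1 to m has squared coefficient
  \<delta>^2 / 2 and weight at most m^(2s), which adds up to at most \<delta>^2 m^(2s+1). All other
  coefficients, including the one at 0, vanish.\<close>

lemma cube_vertex_in_sobolev_class: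
  assumes n: "2 * m < n" and s: "s \<ge> 0" and \<delta>: "\<delta>\<^sup>2 * real m powr (2 * s + 1) \<le> R\<^sup>2"
  shows "cube_vertex \<delta> m S \<in> sobolev_class n s R"
proof -
  let ?A = "{- ((int n - 1) div 2) .. (int n - 1) div 2}"
  let ?B = "{- int m .. int m} - {0}"
  let ?c = "\<delta>\<^sup>2 / 2 * real m powr (2 * s)"
  have A: "2 * \<bar>\<nu>\<bar> < int n" if "\<nu> \<in> ?A" for \<nu>
    using that n by auto
  have "(\<Sum>\<nu>\<in>?A. (cmod (fourier_coeff n (cube_vertex \<delta> m S) \<nu>))\<^sup>2 * \<bar>real_of_int \<nu>\<bar> powr (2 * s))
      \<le> (\<Sum>\<nu>\<in>?A. if \<nu> \<in> ?B then ?c else 0)"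
  proof (rule sum_mono)
    fix \<nu> assume \<nu>: "\<nu> \<in> ?A"
    show "(cmod (fourier_coeff n (cube_vertex \<delta> m S) \<nu>))\<^sup>2 * \<bar>real_of_int \<nu>\<bar> powr (2 * s)
        \<le> (if \<nu> \<in> ?B then ?c else 0)"
    proof (cases "\<nu> \<in> ?B")
      case True
      then have in_m: "nat \<bar>\<nu>\<bar> \<in> {1..m}" by auto
      have "(cmod (fourier_coeff n (cube_vertex \<delta> m S) \<nu>))\<^sup>2 = \<delta>\<^sup>2 / 2"
        unfolding fourier_coeff_cube_vertex[OF n A[OF \<nu>]] using in_m
        by (simp only: if_True norm_of_real power2_abs)
           (simp add: vertex_sign_def power_mult_distrib power_divide)
      moreover
      have "\<bar>real_of_int \<nu>\<bar> powr (2 * s) \<le> real m powr (2 * s)"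
        using s True by (intro powr_mono2) auto
      then have "\<delta>\<^sup>2 / 2 * \<bar>real_of_int \<nu>\<bar> powr (2 * s) \<le> ?c"
        by (intro mult_left_mono) auto
      ultimately show ?thesis using True by (simp only: if_True)
    next
      case False
      then have "nat \<bar>\<nu>\<bar> \<notin> {1..m}" by auto
      with False show ?thesis
        by (simp only: fourier_coeff_cube_vertex[OF n A[OF \<nu>]]) simp
    qed
  qed
  also have "\<dots> = (\<Sum>\<nu>\<in>?A \<inter> ?B. ?c)"
    by (rule sum.inter_restrict[symmetric]) simp
  also have "\<dots> \<le> (\<Sum>\<nu>\<in>?B. ?c)"
    by (intro sum_mono2) auto
  also have "card ?B = 2 * m" by (subst card_Diff_singleton) auto
  then have "(\<Sum>\<nu>\<in>?B. ?c) = \<delta>\<^sup>2 * (real m powr (2 * s) * real m)"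
    by (simp add: algebra_simps)
  also have "\<dots> = \<delta>\<^sup>2 * real m powr (2 * s + 1)"
    by (simp add: powr_add)
  also note \<delta>
  finally show ?thesis
    using n fourier_coeff_cube_vertex[OF n, of 0] by (simp add: sobolev_class_def)
qed

lemma cube_vertex_flip:
  assumes "k \<in> {1..m}"
  shows "cube_vertex \<delta> m S x - cube_vertex \<delta> m (sym_diff S {k}) x = 2 * \<delta> * vertex_sign S k * grid_cos k x"
proof -
  have "cube_vertex \<delta> m S x - cube_vertex \<delta> m (sym_diff S {k}) x
      = (\<Sum>l\<in>{1..m}. if l = k then 2 * \<delta> * vertex_sign S k * grid_cos k x else 0)"
    unfolding cube_vertex_def sum_subtractf[symmetric]
    by (intro sum.cong) (auto simp: vertex_sign_def)
  then show ?thesis using assms by (simp add: sum.delta)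
qed

text \<open>Neighbouring vertices differ by a single cosine of amplitude 2 \<delta>, so their
  distance does not depend on the vertex or the frequency.\<close>

lemma sum_square_cube_vertex_flip:
  assumes "k \<in> {1..m}" "2 * m < n"
  shows "(\<Sum>i<n. (cube_vertex \<delta> m S (real i / real n)
            - cube_vertex \<delta> m (sym_diff S {k}) (real i / real n))\<^sup>2) = 4 * \<delta>\<^sup>2 * real n"
proof -
  have "(\<Sum>i<n. (cube_vertex \<delta> m S (real i / real n)
            - cube_vertex \<delta> m (sym_diff S {k}) (real i / real n))\<^sup>2)
      = (\<Sum>i<n. 4 * \<delta>\<^sup>2 * (grid_cos k (real i / real n) * grid_cos k (real i / real n)))"
    unfolding cube_vertex_flip[OF assms(1)]
    by (intro sum.cong) (auto simp: vertex_sign_def power_mult_distrib power2_eq_square)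
  also have "\<dots> = 4 * \<delta>\<^sup>2 * real n"
    using assms by (simp add: sum_distrib_left[symmetric] grid_cos_orthonormal)
  finally show ?thesis .
qed

lemma cube_vertex_component:
  assumes "k \<in> {1..m}" "2 * m < n"
  shows "(\<Sum>i<n. cube_vertex \<delta> m S (real i / real n) * grid_cos k (real i / real n)) / real n
       = \<delta> * vertex_sign S k"
proof -
  have "(\<Sum>i<n. cube_vertex \<delta> m S (real i / real n) * grid_cos k (real i / real n))
      = (\<Sum>l\<in>{1..m}. \<delta> * vertex_sign S l *
          (\<Sum>i<n. grid_cos l (real i / real n) * grid_cos k (real i / real n)))"
    unfolding cube_vertex_def sum_distrib_right sum_distrib_left
    by (subst sum.swap) (simp add: mult.assoc)
  also have "\<dots> = (\<Sum>l\<in>{1..m}. if l = k then \<delta> * vertex_sign S k * real n else 0)"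
    using assms by (intro sum.cong) (auto simp: grid_cos_orthonormal)
  finally show ?thesis using assms by (simp add: sum.delta)
qed

subsection \<open>The lower bound\<close>

text \<open>Pairing each \<open>S\<close> with the set that differs from it in \<open>k\<close> only averages the
  two-point bounds over the hypercube.\<close>
lemma assouad_averaging:
  fixes F :: "'a set \<Rightarrow> 'a \<Rightarrow> ennreal"
  assumes K: "finite K" and B: "B \<ge> 0"
    and F: "\<And>S. S \<subseteq> K \<Longrightarrow> (\<Sum>k\<in>K. F S k) \<le> M"
    and flip: "\<And>S k. S \<subseteq> K \<Longrightarrow> k \<in> K \<Longrightarrow> ennreal B \<le> F S k + F (sym_diff S {k}) k"
  shows "ennreal (real (card K) * B / 2) \<le> M"
proof -
  let ?P = "of_nat (card (Pow K)) :: ennreal"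
  have "?P * ennreal B \<le> 2 * (\<Sum>S\<in>Pow K. F S k)" if k: "k \<in> K" for k
  proof -
    have "?P * ennreal B = (\<Sum>S\<in>Pow K. ennreal B)" by simp
    also have "\<dots> \<le> (\<Sum>S\<in>Pow K. F S k + F (sym_diff S {k}) k)"
      using k by (intro sum_mono flip) auto
    also have "\<dots> = (\<Sum>S\<in>Pow K. F S k) + (\<Sum>S\<in>Pow K. F (sym_diff S {k}) k)"
      by (rule sum.distrib)
    \<comment> \<open>Flipping the sign at \<open>k\<close> is an involution of the hypercube, so it
      only permutes the summands.\<close>
    also have "(\<Sum>S\<in>Pow K. F (sym_diff S {k}) k) = (\<Sum>S\<in>Pow K. F S k)"
      using k by (intro sum.reindex_bij_witness[of _ "\<lambda>S. sym_diff S {k}" "\<lambda>S. sym_diff S {k}"]) auto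
    finally show ?thesis by (simp add: mult_2)
  qed
  then have "(\<Sum>k\<in>K. ?P * ennreal B) \<le> (\<Sum>k\<in>K. 2 * (\<Sum>S\<in>Pow K. F S k))"
    by (rule sum_mono)
  also have "\<dots> = 2 * (\<Sum>S\<in>Pow K. \<Sum>k\<in>K. F S k)"
    by (subst sum.swap) (simp add: sum_distrib_left)
  also have "\<dots> \<le> 2 * (\<Sum>S\<in>Pow K. M)"
    by (intro mult_left_mono sum_mono F) auto
  also have "\<dots> = ?P * (2 * M)" by (simp add: mult_ac)
  finally have "?P * (of_nat (card K) * ennreal B) \<le> ?P * (2 * M)"
    by (simp add: mult_ac)
  \<comment> \<open>The number of vertices is positive and finite, which is what cancelling it in
    \<open>ennreal\<close> requires.\<close>
  moreover have "?P \<noteq> 0" "?P \<noteq> \<top>"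
    using K by (simp_all del: of_nat_power of_nat_numeral add: card_Pow)
  ultimately have "of_nat (card K) * ennreal B \<le> 2 * M"
    by (simp add: ennreal_mult_le_mult_iff del: of_nat_power)
  moreover have "of_nat (card K) * ennreal B = 2 * ennreal (real (card K) * B / 2)"
    using B by (simp add: ennreal_of_nat_eq_real_of_nat ennreal_mult''[symmetric]
        ennreal_numeral[symmetric] del: ennreal_numeral)
  ultimately show ?thesis
    by (simp add: ennreal_mult_le_mult_iff)
qed

section \<open>Risk of an estimator over the hypercube\<close>

text \<open>The coefficient of the estimate along \<open>grid_cos k\<close>. At a vertex it serves
  as a real-valued estimator of \<open>\<delta> * vertex_sign S k\<close>, the coefficient of the
  true function.\<close>

definition data_component :: "nat \<Rightarrow> ((nat \<Rightarrow> real) \<Rightarrow> real \<Rightarrow> real) \<Rightarrow> nat \<Rightarrow> (nat \<Rightarrow> real) \<Rightarrow> real" where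
  "data_component n T k y = (\<Sum>i<n. T y (real i / real n) * grid_cos k (real i / real n)) / real n"

lemma borel_measurable_data_component:
  assumes "T \<in> estimators n"
  shows "data_component n T k \<in> borel_measurable (\<Pi>\<^sub>M i\<in>{..<n}. borel)"
proof -
  have "(\<lambda>y. T y (real i / real n)) \<in> borel_measurable (\<Pi>\<^sub>M i\<in>{..<n}. borel)" if "i < n" for i
    using assms that by (auto simp: estimators_def)
  then show ?thesis
    unfolding data_component_def[abs_def]
    by (intro borel_measurable_divide borel_measurable_sum borel_measurable_times) auto
qed

lemma measurable_observation:
  "observation n a0 f \<in> measurable (noise n N \<sigma>) (\<Pi>\<^sub>M i\<in>{..<n}. borel)"
  unfolding observation_def noise_def by measurable

text \<open>For each fixed data vector this is Bessel's inequality for the estimation error, with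
  \<open>c = n\<close> matching the normalisation of the risk; it is then integrated over the
  noise.\<close>

lemma AMSE_cube_vertex_ge:
  assumes T: "T \<in> estimators n" and m: "2 * m < n"
  shows "(\<Sum>k\<in>{1..m}. \<integral>\<^sup>+\<epsilon>. ennreal ((data_component n T k (observation n a0 (cube_vertex \<delta> m S) \<epsilon>)
              - \<delta> * vertex_sign S k)\<^sup>2) \<partial>noise n N \<sigma>)
       \<le> AMSE n N \<sigma> a0 T (cube_vertex \<delta> m S)"
proof -
  let ?f = "cube_vertex \<delta> m S"
  let ?y = "observation n a0 ?f"
  let ?X = "data_component n T"
  have n: "n > 0" using m by simp
  have [measurable]: "(\<lambda>\<epsilon>. ?X k (?y \<epsilon>)) \<in> borel_measurable (noise n N \<sigma>)" for k
    by (rule measurable_compose[OF measurable_observation borel_measurable_data_component[OF T]])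
  have bessel: "(\<Sum>k\<in>{1..m}. (?X k y - \<delta> * vertex_sign S k)\<^sup>2)
      \<le> 1 / real n * (grid_norm n (\<lambda>x. T y x - ?f x))\<^sup>2" for y
  proof -
    let ?g = "\<lambda>i. T y (real i / real n) - ?f (real i / real n)"
    have "?X k y - \<delta> * vertex_sign S k = (\<Sum>i<n. ?g i * grid_cos k (real i / real n)) / real n"
      if "k \<in> {1..m}" for k
      unfolding cube_vertex_component[OF that m, symmetric] data_component_def
      by (simp add: left_diff_distrib sum_subtractf diff_divide_distrib)
    then have "(\<Sum>k\<in>{1..m}. (?X k y - \<delta> * vertex_sign S k)\<^sup>2)
        = (\<Sum>k\<in>{1..m}. ((\<Sum>i<n. ?g i * grid_cos k (real i / real n)) / real n)\<^sup>2)"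
      by simp
    also have "\<dots> \<le> (\<Sum>i<n. (?g i)\<^sup>2) / real n"
      by (rule bessel_inequality) (use m n in \<open>simp_all add: grid_cos_orthonormal\<close>)
    also have "\<dots> = 1 / real n * (grid_norm n (\<lambda>x. T y x - ?f x))\<^sup>2"
      by (simp add: grid_norm_def L2_set_def sum_nonneg)
    finally show ?thesis .
  qed
  have "(\<Sum>k\<in>{1..m}. \<integral>\<^sup>+\<epsilon>. ennreal ((?X k (?y \<epsilon>) - \<delta> * vertex_sign S k)\<^sup>2) \<partial>noise n N \<sigma>)
      = (\<integral>\<^sup>+\<epsilon>. (\<Sum>k\<in>{1..m}. ennreal ((?X k (?y \<epsilon>) - \<delta> * vertex_sign S k)\<^sup>2)) \<partial>noise n N \<sigma>)"
    by (rule nn_integral_sum[symmetric]) measurable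
  \<comment> \<open>Of this factor 1, the part \<open>1 / real n\<close> becomes the one in
    \<open>AMSE\<close>, while \<open>real n\<close> moves under the integral to meet Bessel's
    inequality.\<close>
  also have "\<dots> = ennreal (1 / real n * real n) * \<dots>"
    using n by simp
  also have "\<dots> = ennreal (1 / real n) * (\<integral>\<^sup>+\<epsilon>. ennreal (real n) *
      (\<Sum>k\<in>{1..m}. ennreal ((?X k (?y \<epsilon>) - \<delta> * vertex_sign S k)\<^sup>2)) \<partial>noise n N \<sigma>)"
    by (subst nn_integral_cmult, measurable) (simp only: ennreal_mult' mult.assoc divide_nonneg_nonneg
        zero_le_one of_nat_0_le_iff)
  also have "\<dots> \<le> ennreal (1 / real n) * (\<integral>\<^sup>+\<epsilon>. ennreal ((grid_norm n (\<lambda>x. T (?y \<epsilon>) x - ?f x))\<^sup>2) \<partial>noise n N \<sigma>)"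
  proof (intro mult_left_mono nn_integral_mono)
    fix \<epsilon>
    have "real n * (\<Sum>k\<in>{1..m}. (?X k (?y \<epsilon>) - \<delta> * vertex_sign S k)\<^sup>2)
        \<le> (grid_norm n (\<lambda>x. T (?y \<epsilon>) x - ?f x))\<^sup>2"
      using bessel[of "?y \<epsilon>"] n by (simp add: field_simps)
    then show "ennreal (real n) * (\<Sum>k\<in>{1..m}. ennreal ((?X k (?y \<epsilon>) - \<delta> * vertex_sign S k)\<^sup>2))
        \<le> ennreal ((grid_norm n (\<lambda>x. T (?y \<epsilon>) x - ?f x))\<^sup>2)"
      by (simp add: ennreal_mult'[symmetric] ennreal_leI)
  qed simp
  finally show ?thesis by (simp add: AMSE_def)
qed

text \<open>The squared distance 4 \<delta>^2 n of the means is divided by four times the noise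
  variance n \<sigma>^2 / N. So \<open>n\<close> cancels and the exponent depends only on \<delta>^2
  N / \<sigma>^2; \<open>a0\<close> cancels in the difference of the means. The targets lie 2
  |\<delta>| apart.\<close>

lemma two_point_observation:
  fixes a0 \<delta> \<sigma> :: real
  assumes T: "T \<in> estimators n" and m: "2 * m < n" and k: "k \<in> {1..m}" and N: "N > 0" and \<sigma>: "\<sigma> > 0"
  defines "F \<equiv> \<lambda>S. \<integral>\<^sup>+\<epsilon>. ennreal ((data_component n T k (observation n a0 (cube_vertex \<delta> m S) \<epsilon>)
              - \<delta> * vertex_sign S k)\<^sup>2) \<partial>noise n N \<sigma>"
  shows "ennreal (2 * \<delta>\<^sup>2 * exp (- (\<delta>\<^sup>2 * real N / \<sigma>\<^sup>2))) \<le> F S + F (sym_diff S {k})"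
proof -
  let ?\<tau> = "sqrt (real n / real N * \<sigma>\<^sup>2)"
  let ?S' = "sym_diff S {k}"
  let ?\<mu> = "\<lambda>S i. a0 + cube_vertex \<delta> m S (real i / real n)"
  have \<tau>: "?\<tau> > 0" using m N \<sigma> by simp
  have "(\<Sum>i<n. (?\<mu> S i - ?\<mu> ?S' i)\<^sup>2) = 4 * \<delta>\<^sup>2 * real n"
    using sum_square_cube_vertex_flip[OF k m, of \<delta> S] by (simp only: add_diff_cancel_left)
  then have "- (\<Sum>i<n. (?\<mu> S i - ?\<mu> ?S' i)\<^sup>2) / (4 * ?\<tau>\<^sup>2) = - (\<delta>\<^sup>2 * real N / \<sigma>\<^sup>2)"
    using m N \<sigma> by (simp add: field_simps)
  moreover have "(\<delta> * vertex_sign S k - \<delta> * vertex_sign ?S' k)\<^sup>2 / 2 = 2 * \<delta>\<^sup>2"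
    by (auto simp: vertex_sign_def power2_eq_square)
  ultimately show ?thesis
    using two_point_lower_bound[OF _ \<tau> borel_measurable_data_component[OF T, of k],
        of "\<delta> * vertex_sign S k" "\<delta> * vertex_sign ?S' k" "?\<mu> S" "?\<mu> ?S'"]
    unfolding F_def noise_def observation_def by (simp only: finite_lessThan simp_thms True_implies_equals)
qed

text \<open>The supremum dominates the risk at every vertex, so averaging over the hypercube applies
  with \<open>m\<close> frequencies; the halving there absorbs the 2 of the two-point bound.\<close>

lemma sup_AMSE_ge:
  assumes T: "T \<in> estimators n" and m: "2 * m < n" and N: "N > 0" and \<sigma>: "\<sigma> > 0" and s: "s \<ge> 0"
    and \<delta>: "\<delta>\<^sup>2 * real m powr (2 * s + 1) \<le> R\<^sup>2"
  shows "ennreal (real m * \<delta>\<^sup>2 * exp (- (\<delta>\<^sup>2 * real N / \<sigma>\<^sup>2)))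
       \<le> (SUP f\<in>sobolev_class n s R. AMSE n N \<sigma> a0 T f)"
proof -
  let ?M = "SUP f\<in>sobolev_class n s R. AMSE n N \<sigma> a0 T f"
  let ?F = "\<lambda>S k. \<integral>\<^sup>+\<epsilon>. ennreal ((data_component n T k (observation n a0 (cube_vertex \<delta> m S) \<epsilon>)
              - \<delta> * vertex_sign S k)\<^sup>2) \<partial>noise n N \<sigma>"
  have "(\<Sum>k\<in>{1..m}. ?F S k) \<le> ?M" for S
    by (rule SUP_upper2, rule cube_vertex_in_sobolev_class[OF m s \<delta>], rule AMSE_cube_vertex_ge[OF T m])
  then have "ennreal (real (card {1..m}) * (2 * \<delta>\<^sup>2 * exp (- (\<delta>\<^sup>2 * real N / \<sigma>\<^sup>2))) / 2) \<le> ?M"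
    by (intro assouad_averaging[where F = ?F] two_point_observation[OF T m _ N \<sigma>]) auto
  then show ?thesis by (simp add: mult.assoc)
qed

section \<open>Choice of the parameters and conclusion\<close>

text \<open>Multiplied by \<open>N\<close>, the rate is the minimum of N^(1/(2s+1)) and
  \<open>n\<close>. The cut-off \<open>m\<close> is the minimum of their discrete counterparts, each
  at least a third of the original.\<close>

lemma frequency_choice:
  fixes s :: real
  assumes s: "s > 1 / 2" and n: "odd n" "n > 1" and N: "N > 0"
  obtains m :: nat where "2 * m < n" "real m powr (2 * s + 1) \<le> real N"
    "real N * min (real N powr (- (2 * s) / (2 * s + 1))) (real n / real N) \<le> 3 * real m"
proof
  define x where "x = real N powr (1 / (2 * s + 1))"
  let ?m = "min ((n - 1) div 2) (nat \<lfloor>x\<rfloor>)"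
  have x: "x \<ge> 1" unfolding x_def using N s by (intro ge_one_powr_ge_zero) auto
  show "2 * ?m < n" using n by (auto simp: min_def)
  have "real ?m powr (2 * s + 1) \<le> x powr (2 * s + 1)"
    using x s by (intro powr_mono2) (auto simp: min_def, linarith+)
  also have "\<dots> = real N" using s N by (simp add: x_def powr_powr)
  finally show "real ?m powr (2 * s + 1) \<le> real N" .
  have "real N * real N powr (- (2 * s) / (2 * s + 1)) = real N powr (1 + - (2 * s) / (2 * s + 1))"
    by (simp only: powr_mult_base of_nat_0_le_iff)
  also have "1 + - (2 * s) / (2 * s + 1) = 1 / (2 * s + 1)"
    using s by (simp add: field_simps)
  finally have "real N * real N powr (- (2 * s) / (2 * s + 1)) = x"
    by (simp add: x_def)
  then have eq: "real N * min (real N powr (- (2 * s) / (2 * s + 1))) (real n / real N) = min x (real n)"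
    using N by (simp add: min_mult_distrib_left)
  \<comment> \<open>As x \<ge> 1, its floor is at least 1 and rounding down loses less than a factor
    2.\<close>
  have "x \<le> 3 * real (nat \<lfloor>x\<rfloor>)"
  proof -
    have "\<lfloor>x\<rfloor> \<ge> 1" using x by simp
    then have "real_of_int \<lfloor>x\<rfloor> \<ge> 1" "real (nat \<lfloor>x\<rfloor>) = real_of_int \<lfloor>x\<rfloor>" by simp_all
    then show ?thesis using floor_correct[of x] by linarith
  qed
  \<comment> \<open>The constant 3 comes from here: it is attained at n = 3, the smallest odd n
    above 1.\<close>
  moreover have "real n \<le> 3 * real ((n - 1) div 2)"
  proof -
    obtain t where "n = 2 * t + 1" using n by (auto elim: oddE)
    then show ?thesis using n by simp
  qed
  ultimately show "real N * min (real N powr (- (2 * s) / (2 * s + 1))) (real n / real N) \<le> 3 * real ?m"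
    unfolding eq by (auto simp: min_def)
qed

text \<open>\<open>C2\<close> is chosen before the lattice sizes, \<open>N\<close> and
  \<open>a0\<close>, so the bound is uniform in them. For \<open>n j = 1\<close> the class forces
  the only grid value to be 0, the zero estimator has risk 0, and no positive bound can hold; hence
  \<open>n j > 1\<close>.\<close>

theorem proposition2:
  fixes d j :: nat and s R C_R \<sigma> :: real
  assumes "j \<in> {1..d}"
    and "s > 1 / 2" and "0 < R" and "R < C_R" and "\<sigma> > 0"
  shows "\<exists>C2>0. \<forall>(n :: nat \<Rightarrow> nat) (N :: nat) (a0 :: real).
           (\<forall>l\<in>{1..d}. odd (n l)) \<and> n j > 1 \<and> N = (\<Prod>l\<in>{1..d}. n l) \<longrightarrow>
           (INF T\<in>estimators (n j). SUP f\<in>sobolev_class (n j) s R. AMSE (n j) N \<sigma> a0 T f)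
             \<ge> ennreal (C2 * min (real N powr (- (2 * s) / (2 * s + 1))) (real (n j) / real N))"
proof -
  \<comment> \<open>With \<delta>^2 = c / N, the bound c \<le> R^2 puts the hypercube into the
    class, and c \<le> \<sigma>^2 keeps the exponential above \<open>exp (- 1)\<close>. The 3 in
    \<open>C2\<close> is the loss in \<open>frequency_choice\<close>.\<close>
  define c where "c = min (\<sigma>\<^sup>2) (R\<^sup>2)"
  have c: "c > 0" "c \<le> \<sigma>\<^sup>2" "c \<le> R\<^sup>2" using assms by (auto simp: c_def)
  define C2 where "C2 = c * exp (- 1) / 3"
  have "ennreal (C2 * min (real N powr (- (2 * s) / (2 * s + 1))) (real n / real N))
      \<le> (SUP f\<in>sobolev_class n s R. AMSE n N \<sigma> a0 T f)"
    if n: "odd n" "n > 1" and N: "N > 0" and T: "T \<in> estimators n" for n N a0 T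
  proof -
    let ?r = "min (real N powr (- (2 * s) / (2 * s + 1))) (real n / real N)"
    obtain m where m: "2 * m < n" "real m powr (2 * s + 1) \<le> real N" "real N * ?r \<le> 3 * real m"
      using frequency_choice[OF \<open>s > 1 / 2\<close> n N] by blast
    define \<delta> where "\<delta> = sqrt (c / real N)"
    have \<delta>: "\<delta>\<^sup>2 = c / real N" using c by (simp add: \<delta>_def)
    have "c / real N * real m powr (2 * s + 1) \<le> c / real N * real N"
      using m c by (intro mult_left_mono) auto
    then have smooth: "\<delta>\<^sup>2 * real m powr (2 * s + 1) \<le> R\<^sup>2"
      using c N by (simp add: \<delta>)
    have "\<delta>\<^sup>2 * real N / \<sigma>\<^sup>2 \<le> 1"
      using c N assms by (simp add: \<delta>)
    then have "exp (- 1) \<le> exp (- (\<delta>\<^sup>2 * real N / \<sigma>\<^sup>2))" by simp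
    then have "real m * \<delta>\<^sup>2 * exp (- 1) \<le> real m * \<delta>\<^sup>2 * exp (- (\<delta>\<^sup>2 * real N / \<sigma>\<^sup>2))"
      by (intro mult_left_mono) auto
    moreover have "C2 * ?r \<le> real m * \<delta>\<^sup>2 * exp (- 1)"
    proof -
      have "C2 * ?r = c * exp (- 1) / (3 * real N) * (real N * ?r)"
        using N by (simp add: C2_def)
      also have "\<dots> \<le> c * exp (- 1) / (3 * real N) * (3 * real m)"
        using c m by (intro mult_left_mono) auto
      also have "\<dots> = real m * \<delta>\<^sup>2 * exp (- 1)"
        using N by (simp add: \<delta>)
      finally show ?thesis .
    qed
    ultimately have "ennreal (C2 * ?r) \<le> ennreal (real m * \<delta>\<^sup>2 * exp (- (\<delta>\<^sup>2 * real N / \<sigma>\<^sup>2)))"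
      by (intro ennreal_leI) linarith
    also have "\<dots> \<le> (SUP f\<in>sobolev_class n s R. AMSE n N \<sigma> a0 T f)"
      using assms by (intro sup_AMSE_ge[OF T m(1) N _ _ smooth]) auto
    finally show ?thesis .
  qed
  moreover have "(\<Prod>l\<in>{1..d}. n l) > 0" if "\<forall>l\<in>{1..d}. odd (n l)" for n :: "nat \<Rightarrow> nat"
    using that by (intro prod_pos) (auto intro: odd_pos)
  ultimately have "\<forall>(n :: nat \<Rightarrow> nat) (N :: nat) (a0 :: real).
           (\<forall>l\<in>{1..d}. odd (n l)) \<and> n j > 1 \<and> N = (\<Prod>l\<in>{1..d}. n l) \<longrightarrow>
           (INF T\<in>estimators (n j). SUP f\<in>sobolev_class (n j) s R. AMSE (n j) N \<sigma> a0 T f)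
             \<ge> ennreal (C2 * min (real N powr (- (2 * s) / (2 * s + 1))) (real (n j) / real N))"
    using assms(1) by (intro allI impI INF_greatest) blast
  moreover have "C2 > 0" using c by (simp add: C2_def)
  ultimately show ?thesis by blast
qed

end
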